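(* Let $\alpha(\theta)$ be a real-valued function of $\theta>0$ with $$\lim_{\theta\to\infty}\frac{\alpha(\theta)}{\theta}=\infty,$$ and let $H\in C_b(\bar\nabla)$ be such that the maximum of $H$ over $\bar\nabla$ is achieved at a single point $\mathbf{p}_0$. Define the probability measure $\Xi^H_{\alpha,\theta}$ on $\bar\nabla$ by $$\Xi^H_{\alpha,\theta}(d\mathbf{p})=\frac{e^{\alpha(\theta)H(\mathbf{p})}}{E^{\Xi_\theta}[e^{\alpha(\theta)H(\mathbf{q})}]}\,\Xi_\theta(d\mathbf{p}).$$ Then the family $\{\Xi^H_{\alpha,\theta}\}$ satisfies a large deviation principle on $\bar\nabla$ (as $\theta\to\infty$) with speed $\theta$ and rate function $$S^\infty(\mathbf{p})=\begin{cases}0, & \text{if }\mathbf{p}=\mathbf{p}_0,\\ \infty, & \text{else.}\end{cases}$$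
   Context: **Large deviation principle (LDP).** Let $E$ be a complete separable metric space. A family $\{Q_\theta:\theta>0\}$ of probability measures on $E$ satisfies an LDP (as $\theta\to\infty$) with speed $\theta$ and rate function $I:E\to[0,\infty]$ if for every closed $F\subset E$ and every open $G\subset E$, $\limsup_{\theta\to\infty}\frac1\theta\log Q_\theta\{F\}\le-\inf_{x\in F}I(x)$ and $\liminf_{\theta\to\infty}\frac1\theta\log Q_\theta\{G\}\ge-\inf_{x\in G}I(x)$, and for every $c>0$ the set $\{x:I(x)\le c\}$ is compact. (Conventions: $\log 0=-\infty$, $\inf\emptyset=\infty$.) **The Poisson–Dirichlet distribution.** For $\theta>0$, let $U_1,U_2,\ldots$ be i.i.d. with $Beta(1,\theta)$ distribution (density $\theta(1-x)^{\theta-1}$ on $(0,1)$). Put $X_1=U_1$ and $X_k=(1-U_1)\cdots(1-U_{k-1})U_k$ for $k\ge2$. Let $P_k(\theta)$ be the $k$th largest among $X_1,X_2,\ldots$, i.e. $\mathbf{P}(\theta)=(P_1(\theta),P_2(\theta),\ldots)$ is the sequence $(X_k)$ rearranged in descending order. The law of $\mathbf{P}(\theta)$ is the Poisson–Dirichlet distribution $PD(\theta)$. **State space.** $\bar\nabla=\{(p_1,p_2,\ldots):p_1\ge p_2\ge\cdots\ge0,\ \sum_{k=1}^\infty p_k\le1\}$, with the subspace topology inherited from the product topology of $\mathbb{R}^\infty$; it is metrized by $d(\mathbf{p},\mathbf{q})=\sum_{k=1}^\infty|p_k-q_k|/2^k$ and is compact. $\Xi_\theta$ denotes the law of $\mathbf{P}(\theta)$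 on $\bar\nabla$, $E^{\Xi_\theta}$ is expectation under $\Xi_\theta$, and $C_b(\bar\nabla)$ is the set of bounded continuous real functions on $\bar\nabla$. *)

theory Defs
  imports "HOL-Probability.Probability"
begin

section \<open>Large deviation principles\<close>

definition elog :: "real \<Rightarrow> ereal" where
  "elog x = (if x = 0 then - \<infinity> else ereal (ln x))"

text \<open>
  The state space is a subset \<open>E\<close> of the type, with the subspace topology and the Borel
  sigma-algebra; only the topology of \<open>E\<close>, not the choice of metric, enters. The values of
  \<open>Q\<close> at nonpositive arguments are irrelevant. In \<open>ereal\<close> the infimum over the empty set is
  \<open>\<infinity>\<close>, as the usual convention requires.
\<close>

definition satisfies_LDP ::
  "'a::topological_space set \<Rightarrow> (real \<Rightarrow> 'a measure) \<Rightarrow> ('a \<Rightarrow> ereal) \<Rightarrow> bool" where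
  "satisfies_LDP E Q I \<longleftrightarrow>
     (\<forall>\<theta>>0. prob_space (Q \<theta>) \<and> sets (Q \<theta>) = sets (restrict_space borel E)) \<and>
     (\<forall>x\<in>E. 0 \<le> I x) \<and>
     (\<forall>F. closedin (top_of_set E) F \<longrightarrow>
        Limsup at_top (\<lambda>\<theta>. ereal (1 / \<theta>) * elog (measure (Q \<theta>) F)) \<le> - (INF x\<in>F. I x)) \<and>
     (\<forall>G. openin (top_of_set E) G \<longrightarrow>
        - (INF x\<in>G. I x) \<le> Liminf at_top (\<lambda>\<theta>. ereal (1 / \<theta>) * elog (measure (Q \<theta>) G))) \<and>
     (\<forall>c>0. compact {x \<in> E. I x \<le> ereal c})"


section \<open>The Poisson--Dirichlet distribution\<close>

text \<open>
  Sequences are indexed from \<open>0\<close>: entry \<open>k\<close> here is entry \<open>k + 1\<close> in the usual notation.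
  The topology of the function type \<open>nat \<Rightarrow> real\<close> is the product topology.
\<close>

definition nabla :: "(nat \<Rightarrow> real) set" where
  "nabla = {p. antimono p \<and> (\<forall>k. 0 \<le> p k) \<and> summable p \<and> (\<Sum>k. p k) \<le> 1}"

text \<open>
  The underlying space of the \<open>Beta(1, \<theta>)\<close> law is the open unit interval, so that
  all stick-breaking weights below are positive (surely, not just almost surely) and the
  descending rearrangement always exists.
\<close>

definition beta1 :: "real \<Rightarrow> real measure" where
  "beta1 \<theta> = density (restrict_space lborel {0<..<1}) (\<lambda>x. ennreal (\<theta> * (1 - x) powr (\<theta> - 1)))"

definition stick :: "(nat \<Rightarrow> real) \<Rightarrow> nat \<Rightarrow> real" where
  "stick u k = (\<Prod>i<k. 1 - u i) * u k"

text \<open>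
  The description is only meaningful for sequences that have a descending rearrangement;
  it is then unique. Every positive summable sequence has one.
\<close>

definition descending :: "(nat \<Rightarrow> real) \<Rightarrow> nat \<Rightarrow> real" where
  "descending x = (THE p. antimono p \<and> (\<exists>\<sigma>. bij \<sigma> \<and> p = x \<circ> \<sigma>))"

definition PD :: "real \<Rightarrow> (nat \<Rightarrow> real) measure" where
  "PD \<theta> = distr (\<Pi>\<^sub>M i\<in>UNIV. beta1 \<theta>) (restrict_space borel nabla) (\<lambda>u. descending (stick u))"

definition tilted_PD :: "((nat \<Rightarrow> real) \<Rightarrow> real) \<Rightarrow> (real \<Rightarrow> real) \<Rightarrow> real \<Rightarrow> (nat \<Rightarrow> real) measure" where
  "tilted_PD H \<alpha> \<theta> =
     density (PD \<theta>)
       (\<lambda>p. ennreal (exp (\<alpha> \<theta> * H p) / (\<integral>q. exp (\<alpha> \<theta> * H q) \<partial>PD \<theta>)))"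

end

theory Submission imports Defs begin

text \<open>
  The space \<open>nabla\<close> is compact, so on a closed set \<open>F\<close> that misses the maximiser \<open>p0\<close> the function
  \<open>H\<close> stays below \<open>H p0 - 2 * e\<close> for some \<open>e > 0\<close>. Hence the tilted mass of \<open>F\<close> is at most
  \<open>exp (\<alpha> * (H p0 - 2 * e))\<close> divided by the normalising constant, and that constant is at least
  \<open>exp (\<alpha> * (H p0 - e))\<close> times the Poisson--Dirichlet mass of the neighbourhood
  \<open>U = {H > H p0 - e}\<close> of \<open>p0\<close>. If the latter mass is at least \<open>c\<close> to the power \<open>\<theta>\<close> for a
  constant \<open>c > 0\<close>, then \<open>F\<close> has tilted mass at most \<open>exp (- \<alpha> * e - \<theta> * ln c)\<close>. Since
  \<open>\<alpha> / \<theta>\<close> tends to infinity, this beats every exponential rate in \<open>\<theta>\<close>, which is the upper bound.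
  The lower bound follows by applying it to the complement of an open neighbourhood of \<open>p0\<close>: the
  neighbourhood eventually has mass at least one half.

  The estimate on the mass of \<open>U\<close> is \<open>PD_open_ge\<close>, for every nonempty relatively open set.
  It suffices to
  find finitely many open intervals such that every choice of the corresponding stick-breaking
  variables from these intervals, with the other variables arbitrary, leads into the open set
  (\<open>open_event_into_nabla_open\<close>), because a
  single \<open>Beta(1, \<theta>)\<close> variable lies in a given interval with probability at least \<open>c powr \<theta>\<close>
  (\<open>beta1_open_ge\<close>) and the variables are independent. Decreasing rearrangement is 1-Lipschitz for
  the supremum norm (\<open>descending_lipschitz\<close>), so one only has to control all weights uniformly. The
  first \<open>N\<close> weights depend continuously on the first \<open>N\<close> variables, and all later weights are
  bounded by what the first \<open>N\<close> breaks leave over, which is again a function of these variables.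
  It is small near a configuration whose weights sum to one, and sequences with sum one are dense
  in \<open>nabla\<close> (\<open>full_sequences_dense\<close>), since missing mass can be spread over many small entries.
\<close>

section \<open>The descending rearrangement\<close>

text \<open>
  With partial sums in place of the infinite sum, every condition involves finitely many coordinates
  only, so closedness of \<open>nabla\<close> in the product topology becomes visible.
\<close>

lemma nabla_iff:
  "p \<in> nabla \<longleftrightarrow> antimono p \<and> (\<forall>k. 0 \<le> p k) \<and> (\<forall>n. (\<Sum>k<n. p k) \<le> 1)"
proof
  assume "p \<in> nabla"
  then have p: "antimono p" "\<forall>k. 0 \<le> p k" "summable p" "(\<Sum>k. p k) \<le> 1"
    by (auto simp: nabla_def)
  moreover have "(\<Sum>k<n. p k) \<le> 1" for n
    using sum_le_suminf[of p "{..<n}"] p by fastforce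
  ultimately show "antimono p \<and> (\<forall>k. 0 \<le> p k) \<and> (\<forall>n. (\<Sum>k<n. p k) \<le> 1)" by blast
next
  assume p: "antimono p \<and> (\<forall>k. 0 \<le> p k) \<and> (\<forall>n. (\<Sum>k<n. p k) \<le> 1)"
  then have "summable p" by (intro summableI_nonneg_bounded[of p 1]) auto
  with p show "p \<in> nabla" by (auto simp: nabla_def intro: suminf_le_const)
qed

text \<open>
  Breaking ties by the smaller index gives a strict total order in which every index has finitely
  many predecessors, as the entries are positive and tend to zero. Such an order on an infinite set
  has the type of the natural numbers: sending an index to its number of predecessors is a bijection,
  and its inverse is the rearrangement.
\<close>

lemma ex_descending_rearrangement:
  fixes x :: "nat \<Rightarrow> real"
  assumes pos: "\<And>i. 0 < x i" and "summable x"
  shows "\<exists>\<sigma> :: nat \<Rightarrow> nat. bij \<sigma> \<and> antimono (x \<circ> \<sigma>)"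
proof -
  define D where "D i = {j. x i < x j \<or> (x j = x i \<and> j < i)}" for i
  define r where "r i = card (D i)" for i
  have finD: "finite (D i)" for i
  proof -
    have "\<forall>\<^sub>F n in sequentially. x n < x i"
      using \<open>summable x\<close> pos by (intro order_tendstoD(2)[OF summable_LIMSEQ_zero]) auto
    then obtain N where "\<And>n. N \<le> n \<Longrightarrow> x n < x i" by (auto simp: eventually_sequentially)
    then have "D i \<subseteq> {..<N}" by (force simp: D_def not_le[symmetric])
    then show ?thesis using finite_subset by blast
  qed
  have total: "i \<in> D j \<or> j \<in> D i" if "i \<noteq> j" for i j
    using that by (auto simp: D_def)
  have less: "r i < r j" if "i \<in> D j" for i j
  proof -
    have "D i \<subset> D j" using that by (auto simp: D_def)
    then show ?thesis unfolding r_def by (rule psubset_card_mono[OF finD])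
  qed
  have "inj r"
    by (metis injI less less_irrefl total)
  \<comment> \<open>Ranks have no gaps: the greatest predecessor of an index has the preceding rank.\<close>
  have down: "\<exists>j. r j = n" if "r i = Suc n" for i n
  proof -
    have "D i \<noteq> {}" using that by (auto simp: r_def)
    then obtain j where j: "j \<in> D i" "\<And>k. k \<in> D i \<Longrightarrow> r k \<le> r j"
      using finD Max_in[of "r ` D i"] Max_ge[of "r ` D i"] by fastforce
    have "D i = insert j (D j)"
    proof (intro equalityI subsetI)
      fix k assume "k \<in> D i"
      show "k \<in> insert j (D j)"
        using j(2)[OF \<open>k \<in> D i\<close>] less[of j k] total[of k j] by (cases "k = j") auto
    qed (use j in \<open>auto simp: D_def\<close>)
    moreover have "j \<notin> D j" by (auto simp: D_def)
    ultimately have "r i = Suc (r j)" by (simp add: r_def finD)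
    with that show ?thesis by auto
  qed
  have "surj r"
  proof -
    have ge: "n \<in> range r" if "n \<le> r i" for n i
      using that
    proof (induction "r i - n" arbitrary: n)
      case (Suc m)
      then have "Suc n \<in> range r" by (intro Suc.hyps(1)) auto
      then obtain k where "r k = Suc n" by auto
      then show ?case using down by blast
    qed auto
    have "infinite (range r)" using \<open>inj r\<close> finite_imageD by blast
    have "n \<in> range r" for n
    proof -
      obtain m where "m \<in> range r" "n \<le> m"
        using \<open>infinite (range r)\<close> by (meson infinite_nat_iff_unbounded_le)
      then show ?thesis using ge by blast
    qed
    then show ?thesis by auto
  qed
  with \<open>inj r\<close> have "bij r" by (simp add: bij_def)
  moreover have "antimono (x \<circ> inv r)"
  proof (rule antimonoI, simp)
    fix m n :: nat assume "m \<le> n"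
    have "\<not> inv r n \<in> D (inv r m)"
      using less[of "inv r n" "inv r m"] \<open>m \<le> n\<close> \<open>surj r\<close> by (auto simp: surj_f_inv_f)
    then show "x (inv r n) \<le> x (inv r m)" by (auto simp: D_def)
  qed
  ultimately show ?thesis using bij_imp_bij_inv[OF \<open>bij r\<close>] by blast
qed

text \<open>
  This describes the entries of a descending rearrangement without reference to the permutation.
  Uniqueness, measurability and the Lipschitz property all follow from it.
\<close>

lemma rearrangement_gt_iff:
  fixes p x :: "nat \<Rightarrow> real"
  assumes "antimono p" "bij \<sigma>" "p = x \<circ> \<sigma>"
  shows "t < p k \<longleftrightarrow> (\<exists>S. finite S \<and> card S = Suc k \<and> (\<forall>i\<in>S. t < x i))"
proof
  assume "t < p k"
  then have "\<forall>i\<in>\<sigma> ` {..k}. t < x i"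
    using assms by (auto dest!: antimonoD[OF assms(1)] intro: less_le_trans)
  moreover have "card (\<sigma> ` {..k}) = Suc k"
    using \<open>bij \<sigma>\<close> by (subst card_image) (auto simp: bij_def inj_on_def)
  ultimately show "\<exists>S. finite S \<and> card S = Suc k \<and> (\<forall>i\<in>S. t < x i)" by blast
next
  assume "\<exists>S. finite S \<and> card S = Suc k \<and> (\<forall>i\<in>S. t < x i)"
  then obtain S where S: "finite S" "card S = Suc k" "\<forall>i\<in>S. t < x i" by blast
  have "card (inv \<sigma> ` S) = Suc k"
    using S bij_imp_bij_inv[OF \<open>bij \<sigma>\<close>]
    by (subst card_image) (auto simp: bij_def inj_on_def)
  then have "\<not> inv \<sigma> ` S \<subseteq> {..<k}"
    using card_mono[of "{..<k}" "inv \<sigma> ` S"] by auto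
  then obtain i where "i \<in> S" "k \<le> inv \<sigma> i" by force
  then have "p (inv \<sigma> i) \<le> p k" using antimonoD[OF assms(1)] by blast
  moreover have "p (inv \<sigma> i) = x i"
    using assms by (simp add: bij_is_surj surj_f_inv_f)
  ultimately show "t < p k" using S \<open>i \<in> S\<close> by force
qed

lemma descending_eqI:
  fixes p x :: "nat \<Rightarrow> real"
  assumes "antimono p" "bij \<sigma>" "p = x \<circ> \<sigma>"
  shows "descending x = p"
  unfolding descending_def
proof (rule the_equality)
  fix q :: "nat \<Rightarrow> real" assume "antimono q \<and> (\<exists>\<tau>. bij \<tau> \<and> q = x \<circ> \<tau>)"
  then have "t < q k \<longleftrightarrow> t < p k" for t k
    using rearrangement_gt_iff assms by metis
  then show "q = p" by (intro ext) (meson less_irrefl linorder_neq_iff)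
qed (use assms in blast)

lemma descending_rearrangement:
  fixes x :: "nat \<Rightarrow> real"
  assumes "\<And>i. 0 < x i" "summable x"
  obtains \<sigma> :: "nat \<Rightarrow> nat" where "bij \<sigma>" "antimono (descending x)" "descending x = x \<circ> \<sigma>"
  using ex_descending_rearrangement[OF assms] descending_eqI by metis

lemma descending_gt_iff:
  fixes x :: "nat \<Rightarrow> real"
  assumes "\<And>i. 0 < x i" "summable x"
  shows "t < descending x k \<longleftrightarrow> (\<exists>S. finite S \<and> card S = Suc k \<and> (\<forall>i\<in>S. t < x i))"
  using descending_rearrangement[OF assms] rearrangement_gt_iff by metis

lemma descending_antimono:
  fixes q :: "nat \<Rightarrow> real"
  assumes "antimono q"
  shows "descending q = q"
  by (rule descending_eqI[OF assms bij_id]) simp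

text \<open>
  A set of \<open>k + 1\<close> indices at which \<open>x\<close> exceeds a level witnesses that \<open>y\<close> exceeds, at the same
  indices, that level lowered by \<open>e\<close>.
\<close>

lemma descending_lipschitz:
  fixes x y :: "nat \<Rightarrow> real"
  assumes x: "\<And>i. 0 < x i" "summable x" and y: "\<And>i. 0 < y i" "summable y"
    and near: "\<And>i. \<bar>x i - y i\<bar> \<le> e"
  shows "\<bar>descending x k - descending y k\<bar> \<le> e"
proof -
  have le: "descending a k \<le> descending b k + e"
    if a: "\<And>i. 0 < a i" "summable a" and b: "\<And>i. 0 < b i" "summable b"
      and ab: "\<And>i. a i \<le> b i + e" for a b :: "nat \<Rightarrow> real"
  proof (rule ccontr)
    assume "\<not> ?thesis"
    then have "descending b k + e < descending a k" by simp
    then obtain S where S: "finite S" "card S = Suc k" "\<forall>i\<in>S. descending b k + e < a i"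
      using descending_gt_iff[OF a] by blast
    then have "\<forall>i\<in>S. descending b k < b i" using ab by (smt (verit))
    then have "descending b k < descending b k" using S descending_gt_iff[OF b] by blast
    then show False by simp
  qed
  have "x i \<le> y i + e" "y i \<le> x i + e" for i using near[of i] by auto
  then show ?thesis using le[OF x y] le[OF y x] by (simp add: abs_le_iff)
qed

lemma descending_in_nabla:
  fixes x :: "nat \<Rightarrow> real"
  assumes x: "\<And>i. 0 < x i" "summable x" "suminf x \<le> 1"
  shows "descending x \<in> nabla"
proof -
  obtain \<sigma> where \<sigma>: "bij \<sigma>" "antimono (descending x)" "descending x = x \<circ> \<sigma>"
    using descending_rearrangement[OF x(1,2)] by blast
  have "(\<Sum>k<n. descending x k) \<le> 1" for n
  proof -
    have "(\<Sum>k<n. descending x k) = sum x (\<sigma> ` {..<n})"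
      using \<sigma> by (subst sum.reindex) (auto simp: bij_def inj_on_def)
    also have "\<dots> \<le> suminf x"
      using x by (intro sum_le_suminf) (auto intro: less_imp_le)
    finally show ?thesis using x by simp
  qed
  then show ?thesis using \<sigma> x(1) by (auto simp: nabla_iff intro: less_imp_le)
qed

section \<open>Stick breaking\<close>

lemma sum_stick: "(\<Sum>k<n. stick u k) = 1 - (\<Prod>i<n. 1 - u i)"
  by (induction n) (auto simp: stick_def algebra_simps)

context
  fixes u :: "nat \<Rightarrow> real"
  assumes u: "\<And>i. u i \<in> {0<..<1}"
begin

lemma stick_pos: "0 < stick u k"
  unfolding stick_def using u by (intro mult_pos_pos prod_pos) auto

lemma sum_stick_le_1: "(\<Sum>k<n. stick u k) \<le> 1"
proof -
  have "0 \<le> (\<Prod>i<n. 1 - u i)" using u by (intro prod_nonneg) (auto simp: less_imp_le)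
  then show ?thesis by (simp add: sum_stick)
qed

lemma summable_stick: "summable (stick u)"
  using stick_pos sum_stick_le_1 by (intro summableI_nonneg_bounded[of _ 1]) (auto intro: less_imp_le)

lemma descending_stick_in_nabla: "descending (stick u) \<in> nabla"
  by (rule descending_in_nabla[OF stick_pos summable_stick])
    (rule suminf_le_const[OF summable_stick sum_stick_le_1])

text \<open>
  The product is the length of the stick that is left after \<open>n\<close> breaks, and all later pieces are cut
  from it. This bounds all but finitely many weights by a function of finitely many variables.
\<close>

lemma stick_le_remainder:
  assumes "n \<le> k" shows "stick u k \<le> (\<Prod>i<n. 1 - u i)"
proof -
  have "sum (stick u) {..<Suc k} = sum (stick u) {..<n} + sum (stick u) {n..k}"
    using assms sum.atLeastLessThan_concat[of 0 n "Suc k" "stick u"]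
    by (simp add: lessThan_atLeast0 atLeastLessThanSuc_atLeastAtMost)
  moreover have "stick u k \<le> sum (stick u) {n..k}"
    using assms stick_pos by (intro member_le_sum) (auto intro: less_imp_le)
  ultimately show ?thesis using sum_stick_le_1[of "Suc k"] sum_stick[of u n] by simp
qed

end

text \<open>
  The variable to choose is the fraction of the remaining stick that the next entry takes. The sum
  being exactly one, the remaining stick is the tail of the series.
\<close>

lemma ex_stick:
  fixes q :: "nat \<Rightarrow> real"
  assumes pos: "\<And>i. 0 < q i" and q: "q sums 1"
  obtains u where "\<And>i. u i \<in> {0<..<1}" "stick u = q"
proof
  define R where "R n = 1 - (\<Sum>k<n. q k)" for n
  define u where "u k = q k / R k" for k
  have R: "0 < R n" for n
    using sum_less_suminf[of q n] q pos by (auto simp: R_def sums_iff)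
  have RS: "R (Suc n) = R n - q n" for n by (simp add: R_def)
  show "u i \<in> {0<..<1}" for i
    using R[of i] R[of "Suc i"] pos[of i] by (auto simp: u_def RS)
  have "(\<Prod>i<n. 1 - u i) = R n" for n
  proof (induction n)
    case (Suc n)
    then show ?case using R[of n] by (simp add: RS u_def field_simps)
  qed (simp add: R_def)
  then have "stick u k = q k" for k using R[of k] by (simp add: stick_def u_def)
  then show "stick u = q" by auto
qed

lemma continuous_on_stick: "continuous_on UNIV (\<lambda>u. stick u k)"
  unfolding stick_def by (intro continuous_intros continuous_on_product_coordinates)

lemma open_nabla_contains_box:
  assumes U: "openin (top_of_set nabla) U" and "p \<in> U"
  obtains J d where "finite J" "0 < d"
    "\<And>y. y \<in> nabla \<Longrightarrow> (\<And>i. i \<in> J \<Longrightarrow> \<bar>y i - p i\<bar> < d) \<Longrightarrow> y \<in> U"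
proof -
  obtain T where T: "open T" "U = nabla \<inter> T" using U by (auto simp: openin_open)
  then have "openin (product_topology (\<lambda>i. euclidean) UNIV) T" "p \<in> T"
    using \<open>p \<in> U\<close> by (auto simp: open_fun_def)
  from product_topology_open_contains_basis[OF this]
  obtain X where X: "\<And>i. p i \<in> X i" "\<And>i. open (X i)" "finite {i. X i \<noteq> UNIV}"
    "(\<Pi>\<^sub>E i\<in>UNIV. X i) \<subseteq> T"
    by auto
  then have "\<forall>i. \<exists>e>0. \<forall>y. dist y (p i) < e \<longrightarrow> y \<in> X i" by (metis open_dist)
  then obtain e where e: "\<And>i. 0 < e i" "\<And>i y. dist y (p i) < e i \<Longrightarrow> y \<in> X i" by metis
  define J where "J = {i. X i \<noteq> UNIV}"
  define d where "d = Min (insert 1 (e ` J))"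
  have J: "finite J" using X by (simp add: J_def)
  have d: "0 < d" "\<And>i. i \<in> J \<Longrightarrow> d \<le> e i" using J e by (auto simp: d_def)
  show thesis
  proof
    fix y assume y: "y \<in> nabla" "\<And>i. i \<in> J \<Longrightarrow> \<bar>y i - p i\<bar> < d"
    have "y i \<in> X i" for i
    proof (cases "i \<in> J")
      case True
      then show ?thesis using y(2)[of i] d(2)[of i] by (intro e(2)) (auto simp: dist_real_def)
    qed (auto simp: J_def)
    then show "y \<in> U" using X(4) T y(1) by blast
  qed (use J d in auto)
qed

text \<open>
  Shrink \<open>p\<close> slightly and add the missing mass as a multiple of a geometric probability sequence.
  When its ratio is close to one, all entries of that sequence are small, so the result is close to
  \<open>p\<close> in every coordinate although its sum is one. Both summands are decreasing, so no rearrangement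
  is needed.
\<close>

lemma full_sequences_dense:
  assumes U: "openin (top_of_set nabla) U" and "p \<in> U"
  obtains q where "q \<in> U" "\<And>i. 0 < q i" "q sums 1"
proof -
  have p: "p \<in> nabla" using assms openin_imp_subset by blast
  then have p': "antimono p" "\<And>k. 0 \<le> p k" "summable p" "suminf p \<le> 1" by (auto simp: nabla_def)
  define a where "a n = 1 - 1 / real (n + 2)" for n
  define g where "g n k = (1 - a n) * a n ^ k" for n k
  define c where "c n = 1 - a n * suminf p" for n
  define q where "q n k = a n * p k + c n * g n k" for n k
  have a: "0 < a n" "a n < 1" for n by (auto simp: a_def)
  have c: "0 < c n" for n
  proof -
    have "a n * suminf p \<le> a n * 1" using p' a[of n] by (intro mult_left_mono) auto
    then show ?thesis using a[of n] unfolding c_def by linarith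
  qed
  have pos: "0 < q n k" for n k
    using a[of n] c[of n] p'(2)[of k] by (auto simp: q_def g_def intro!: add_nonneg_pos)
  have sums: "q n sums 1" for n
  proof -
    have "(\<lambda>k. a n ^ k) sums (1 / (1 - a n))" using a[of n] by (intro geometric_sums) auto
    from sums_mult[OF this, of "1 - a n"] have "g n sums 1" using a[of n] by (simp add: g_def[abs_def])
    from sums_add[OF sums_mult[OF summable_sums[OF p'(3)], of "a n"] sums_mult[OF this, of "c n"]]
    show ?thesis by (simp add: q_def[abs_def] c_def)
  qed
  have "antimono (q n)" for n
  proof (rule antimonoI)
    fix j k :: nat assume "j \<le> k"
    then have "p k \<le> p j" "a n ^ k \<le> a n ^ j"
      using antimonoD[OF p'(1)] a[of n] by (simp_all add: power_decreasing)
    then show "q n k \<le> q n j" using a[of n] c[of n] unfolding q_def g_def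
      by (intro add_mono mult_left_mono) auto
  qed
  then have qn: "q n \<in> nabla" for n
    using pos sums by (auto simp: nabla_def sums_iff less_imp_le)
  have a_lim: "a \<longlonglongrightarrow> 1"
  proof -
    have "(\<lambda>n. 1 / real (n + 2)) \<longlonglongrightarrow> 0"
      by (rule LIMSEQ_ignore_initial_segment[OF lim_1_over_n])
    from tendsto_diff[OF tendsto_const[of 1] this] show ?thesis by (simp add: a_def[abs_def])
  qed
  have "(\<lambda>n. q n k) \<longlonglongrightarrow> p k" for k
  proof -
    have "(\<lambda>n. q n k) \<longlonglongrightarrow> 1 * p k + (1 - 1 * suminf p) * ((1 - 1) * 1 ^ k)"
      unfolding q_def c_def g_def by (intro tendsto_intros a_lim)
    then show ?thesis by simp
  qed
  then have "\<forall>\<^sub>F n in sequentially. dist (q n k) (p k) < d" if "0 < d" for k d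
    using that by (auto intro: tendstoD)
  moreover obtain J d where J: "finite J" "0 < d"
    "\<And>y. y \<in> nabla \<Longrightarrow> (\<And>i. i \<in> J \<Longrightarrow> \<bar>y i - p i\<bar> < d) \<Longrightarrow> y \<in> U"
    using open_nabla_contains_box[OF assms] by blast
  ultimately have "\<forall>\<^sub>F n in sequentially. \<forall>k\<in>J. dist (q n k) (p k) < d"
    by (intro eventually_ball_finite) auto
  then obtain n where "\<forall>k\<in>J. dist (q n k) (p k) < d" by (auto simp: eventually_sequentially)
  then have "q n \<in> U" using J qn by (auto simp: dist_real_def)
  then show thesis using pos sums by (rule that)
qed

text \<open>
  The map from the stick-breaking variables to the ordered weights is continuous at any \<open>u\<close> whose
  weights sum to one; at other points mass hidden in the tail could be released by a small change.
\<close>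

lemma open_event_into_nabla_open:
  assumes U: "openin (top_of_set nabla) U" and "p \<in> U"
  obtains V u where "open V" "u \<in> V" "\<And>i. u i \<in> {0<..<1}"
    "\<And>v. v \<in> V \<Longrightarrow> (\<And>i. v i \<in> {0<..<1}) \<Longrightarrow> descending (stick v) \<in> U"
proof -
  obtain q where q: "q \<in> U" "\<And>i. 0 < q i" "q sums 1" using full_sequences_dense[OF assms] by blast
  then have "q \<in> nabla" using openin_imp_subset[OF U] by blast
  then have dq: "descending q = q" by (auto simp: nabla_def intro: descending_antimono)
  obtain u where u: "\<And>i. u i \<in> {0<..<1}" "stick u = q" using ex_stick[OF q(2,3)] by blast
  obtain J d where J: "0 < d"
    "\<And>y. y \<in> nabla \<Longrightarrow> (\<And>i. i \<in> J \<Longrightarrow> \<bar>y i - q i\<bar> < d) \<Longrightarrow> y \<in> U"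
    using open_nabla_contains_box[OF U \<open>q \<in> U\<close>] by metis
  define e where "e = d / 2"
  have e: "0 < e" "e < d" using J by (auto simp: e_def)
  have "(\<lambda>n. 1 - (\<Prod>i<n. 1 - u i)) \<longlonglongrightarrow> 1"
    using q(3) sum_stick[of u] by (simp add: u sums_def)
  from tendsto_diff[OF tendsto_const[of 1] this]
  have "(\<lambda>n. \<Prod>i<n. 1 - u i) \<longlonglongrightarrow> 0" by simp
  then obtain N where N: "(\<Prod>i<N. 1 - u i) < e"
    using order_tendstoD(2) e by (metis (no_types, lifting) eventually_sequentially order_refl)
  \<comment> \<open>On \<open>V\<close> the first \<open>N\<close> weights are controlled directly, the others through the remaining stick.\<close>
  define V where "V = {v. (\<Prod>i<N. 1 - v i) < e} \<inter> (\<Inter>i<N. {v. \<bar>stick v i - q i\<bar> < e})"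
  show thesis
  proof
    show "open V" unfolding V_def
      by (intro open_Int open_INT ballI open_Collect_less continuous_intros continuous_on_stick
          continuous_on_product_coordinates) auto
    show "u \<in> V" using N u(2) e by (simp add: V_def)
    show "u i \<in> {0<..<1}" for i by (rule u)
    fix v :: "nat \<Rightarrow> real" assume v: "v \<in> V" "\<And>i. v i \<in> {0<..<1}"
    have "\<bar>stick v i - stick u i\<bar> \<le> e" for i
    proof (cases "i < N")
      case True
      then show ?thesis using v u by (auto simp: V_def less_imp_le)
    next
      case False
      then show ?thesis
        using stick_le_remainder[of v N i] stick_le_remainder[of u N i] stick_pos[of v i] stick_pos[of u i]
          v u(1) N by (auto simp: V_def)
    qed
    then have "\<bar>descending (stick v) i - q i\<bar> \<le> e" for i
      using descending_lipschitz[of "stick v" "stick u" e i] stick_pos summable_stick u v dq by metis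
    then show "descending (stick v) \<in> U"
      using J(2)[OF descending_stick_in_nabla] e v(2) by (meson order_le_less_trans)
  qed
qed

lemma compact_nabla: "compact nabla"
proof -
  have "compactin (product_topology (\<lambda>i. euclidean) UNIV) (\<Pi>\<^sub>E i\<in>(UNIV::nat set). {0..1::real})"
    by (simp add: compactin_PiE)
  then have "compact (\<Pi>\<^sub>E i\<in>(UNIV::nat set). {0..1::real})"
    by (simp add: euclidean_product_topology)
  moreover have "nabla \<subseteq> (\<Pi>\<^sub>E i\<in>UNIV. {0..1})"
  proof
    fix p assume p: "p \<in> nabla"
    have "p k \<le> 1" for k
    proof -
      have "p k \<le> sum p {..<Suc k}" using p by (intro member_le_sum) (auto simp: nabla_iff)
      also have "\<dots> \<le> 1" using p unfolding nabla_iff by blast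
      finally show ?thesis .
    qed
    then show "p \<in> (\<Pi>\<^sub>E i\<in>UNIV. {0..1})" using p by (auto simp: nabla_iff)
  qed
  moreover have "closed nabla"
  proof -
    have "nabla = {p. (\<forall>i j. i \<le> j \<longrightarrow> p j \<le> p i) \<and> (\<forall>k. 0 \<le> p k) \<and> (\<forall>n. (\<Sum>k<n. p k) \<le> 1)}"
      by (auto simp: nabla_iff antimono_def)
    also have "closed \<dots>"
      by (intro closed_Collect_conj closed_Collect_all closed_Collect_imp closed_Collect_le
          continuous_on_sum continuous_on_const continuous_on_product_coordinates) auto
    finally show ?thesis .
  qed
  ultimately show ?thesis by (metis compact_Int_closed inf.absorb2)
qed

section \<open>The law of the stick-breaking variables\<close>

lemma space_beta1 [simp]: "space (beta1 \<theta>) = {0<..<1}"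
  by (simp add: beta1_def space_restrict_space)

lemma sets_beta1 [measurable_cong]: "sets (beta1 \<theta>) = sets (restrict_space borel {0<..<1})"
  by (simp add: beta1_def sets_restrict_space)

lemma emeasure_beta1:
  assumes "A \<subseteq> {0<..<1}" "A \<in> sets borel"
  shows "emeasure (beta1 \<theta>) A = (\<integral>\<^sup>+x. ennreal (\<theta> * (1 - x) powr (\<theta> - 1)) * indicator A x \<partial>lborel)"
proof -
  have "emeasure (beta1 \<theta>) A =
    (\<integral>\<^sup>+x. ennreal (\<theta> * (1 - x) powr (\<theta> - 1)) * indicator A x \<partial>restrict_space lborel {0<..<1})"
    unfolding beta1_def
  proof (rule emeasure_density)
    show "A \<in> sets (restrict_space lborel {0<..<1})"
      using assms by (auto simp: sets_restrict_space)
  qed (intro measurable_restrict_space1; measurable)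
  also have "\<dots> = (\<integral>\<^sup>+x. ennreal (\<theta> * (1 - x) powr (\<theta> - 1)) * indicator A x * indicator {0<..<1} x \<partial>lborel)"
    by (rule nn_integral_restrict_space) auto
  also have "\<dots> = (\<integral>\<^sup>+x. ennreal (\<theta> * (1 - x) powr (\<theta> - 1)) * indicator A x \<partial>lborel)"
    using assms by (intro nn_integral_cong) (auto simp: indicator_def)
  finally show ?thesis .
qed

lemma prob_space_beta1:
  assumes "0 < \<theta>"
  shows "prob_space (beta1 \<theta>)"
proof
  \<comment> \<open>After the reflection \<open>x \<mapsto> 1 - x\<close> the density is a power, integrable at the origin for all \<open>\<theta> > 0\<close>.\<close>
  define g where "g x = (if x \<in> {0..1} then \<theta> * x powr (\<theta> - 1) else 0)" for x :: real
  have [measurable]: "g \<in> borel_measurable borel" unfolding g_def by measurable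
  have "((\<lambda>x. x powr (\<theta> - 1)) has_integral (1 / \<theta>)) {0..1}"
    using has_integral_powr_from_0[of "\<theta> - 1" 1] assms by simp
  from has_integral_mult_right[OF this, of \<theta>]
  have gI: "(g has_integral 1) UNIV"
    using assms unfolding g_def by (subst has_integral_restrict_UNIV) simp
  then have g: "(\<integral>\<^sup>+x. ennreal (g x) \<partial>lborel) = ennreal 1"
    using assms by (intro nn_integral_has_integral_lborel[OF _ _ gI]) (auto simp: g_def)
  have "emeasure (beta1 \<theta>) (space (beta1 \<theta>)) =
      (\<integral>\<^sup>+x. ennreal (\<theta> * (1 - x) powr (\<theta> - 1)) * indicator {0<..<1} x \<partial>lborel)"
    by (simp add: emeasure_beta1)
  also have "\<dots> = (\<integral>\<^sup>+x. ennreal (g (1 + (-1) * x)) \<partial>lborel)"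
    using AE_lborel_singleton[of 0] AE_lborel_singleton[of 1]
    by (intro nn_integral_cong_AE, eventually_elim) (auto simp: g_def indicator_def)
  also have "\<dots> = (\<integral>\<^sup>+x. ennreal (g x) \<partial>lborel)"
    using nn_integral_real_affine[of "\<lambda>x. ennreal (g x)" "-1" 1] by simp
  finally show "emeasure (beta1 \<theta>) (space (beta1 \<theta>)) = 1" using g by simp
qed

text \<open>
  On an interval \<open>{a..b}\<close> inside the unit interval the density is at least \<open>(1 - b) powr \<theta>\<close> when
  \<open>1 \<le> \<theta>\<close>; the factor \<open>b - a\<close> from integrating is below one and is absorbed into the base.
\<close>

lemma beta1_open_ge:
  assumes "open A" "a \<in> A" "a \<in> {0<..<1}"
  obtains c where "0 < c" "\<And>\<theta>. 1 \<le> \<theta> \<Longrightarrow> c powr \<theta> \<le> measure (beta1 \<theta>) (A \<inter> {0<..<1})"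
proof -
  have "open (A \<inter> {0<..<1})" using assms by auto
  then obtain e where e: "0 < e" "cball a e \<subseteq> A \<inter> {0<..<1}"
    using assms open_contains_cball by blast
  define b where "b = a + e"
  have b: "b \<in> {0<..<1}" using e by (auto simp: b_def dist_real_def subset_iff)
  have ab: "{a..b} \<subseteq> A \<inter> {0<..<1}" using e by (auto simp: b_def dist_real_def subset_iff)
  have "((b - a) * (1 - b)) powr \<theta> \<le> measure (beta1 \<theta>) (A \<inter> {0<..<1})" if \<theta>: "1 \<le> \<theta>" for \<theta>
  proof -
    interpret prob_space "beta1 \<theta>" using \<theta> by (intro prob_space_beta1) auto
    have ba: "0 < b - a" "b - a < 1" using e b assms by (auto simp: b_def)
    have "((b - a) * (1 - b)) powr \<theta> = (b - a) powr \<theta> * (1 - b) powr \<theta>"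
      by (rule powr_mult)
    also have "\<dots> \<le> (b - a) * (1 - b) powr \<theta>"
      using powr_mono'[of 1 \<theta> "b - a"] \<theta> ba by (intro mult_right_mono) auto
    finally have "ennreal (((b - a) * (1 - b)) powr \<theta>) \<le> ennreal ((1 - b) powr \<theta> * (b - a))"
      by (intro ennreal_leI) (simp add: mult.commute)
    also have "\<dots> = (\<integral>\<^sup>+x. ennreal ((1 - b) powr \<theta>) * indicator {a..b} x \<partial>lborel)"
      using ba by (simp add: nn_integral_cmult_indicator ennreal_mult)
    also have "\<dots> \<le> (\<integral>\<^sup>+x. ennreal (\<theta> * (1 - x) powr (\<theta> - 1)) * indicator (A \<inter> {0<..<1}) x \<partial>lborel)"
    proof (intro nn_integral_mono)
      fix x :: real
      have "(1 - b) powr \<theta> \<le> \<theta> * (1 - x) powr (\<theta> - 1)" if x: "x \<in> {a..b}"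
      proof -
        have "(1 - b) powr \<theta> \<le> (1 - b) powr (\<theta> - 1)" using b by (intro powr_mono') auto
        also have "\<dots> \<le> (1 - x) powr (\<theta> - 1)" using b x \<theta> by (intro powr_mono2) auto
        also have "\<dots> \<le> \<theta> * (1 - x) powr (\<theta> - 1)" using mult_right_mono[OF \<theta>, of "(1 - x) powr (\<theta> - 1)"] by simp
        finally show ?thesis .
      qed
      then show "ennreal ((1 - b) powr \<theta>) * indicator {a..b} x
          \<le> ennreal (\<theta> * (1 - x) powr (\<theta> - 1)) * indicator (A \<inter> {0<..<1}) x"
        using ab by (auto simp: indicator_def intro!: ennreal_leI)
    qed
    also have "\<dots> = emeasure (beta1 \<theta>) (A \<inter> {0<..<1})"
      using \<open>open A\<close> by (intro emeasure_beta1[symmetric]) auto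
    finally show ?thesis by (simp add: emeasure_eq_measure)
  qed
  moreover have "0 < (b - a) * (1 - b)" using e b by (auto simp: b_def)
  ultimately show thesis by (intro that) auto
qed

section \<open>The Poisson--Dirichlet law\<close>

abbreviation stick_space :: "real \<Rightarrow> (nat \<Rightarrow> real) measure" where
  "stick_space \<theta> \<equiv> \<Pi>\<^sub>M i\<in>UNIV. beta1 \<theta>"

lemma in_stick_space: "u \<in> space (stick_space \<theta>) \<longleftrightarrow> (\<forall>i. u i \<in> {0<..<1})"
  by (auto simp: space_PiM PiE_iff)

lemma measurable_stick: "(\<lambda>u. stick u k) \<in> borel_measurable (stick_space \<theta>)"
proof -
  have "(\<lambda>x. x) \<in> borel_measurable (beta1 \<theta>)"
    by (subst measurable_cong_sets[OF sets_beta1 refl]) (rule measurable_restrict_space1, simp)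
  then have [measurable]: "(\<lambda>u. u i) \<in> borel_measurable (stick_space \<theta>)" for i
    using measurable_compose[OF measurable_component_singleton[of i UNIV "\<lambda>_. beta1 \<theta>"]] by simp
  show ?thesis unfolding stick_def by measurable
qed

text \<open>
  The \<open>k\<close>-th ordered weight exceeds a level iff the weights do so on some set of \<open>k + 1\<close> indices, and
  there are only countably many such sets.
\<close>

lemma measurable_descending_stick:
  "(\<lambda>u. descending (stick u)) \<in> stick_space \<theta> \<rightarrow>\<^sub>M restrict_space borel nabla"
proof (rule measurable_restrict_space2)
  show "(\<lambda>u. descending (stick u)) \<in> space (stick_space \<theta>) \<rightarrow> nabla"
    using descending_stick_in_nabla by (auto simp: in_stick_space)
  show "(\<lambda>u. descending (stick u)) \<in> borel_measurable (stick_space \<theta>)"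
  proof (intro measurable_coordinatewise_then_product)
    fix k
    have "{u \<in> space (stick_space \<theta>). t < descending (stick u) k} \<in> sets (stick_space \<theta>)" for t
    proof -
      let ?K = "{S :: nat set. finite S \<and> card S = Suc k}"
      have "{u \<in> space (stick_space \<theta>). t < descending (stick u) k} =
        (\<Union>S\<in>?K. {u \<in> space (stick_space \<theta>). \<forall>i\<in>S. t < stick u i})"
        using descending_gt_iff[OF stick_pos summable_stick] by (auto simp: in_stick_space)
      also have "\<dots> \<in> sets (stick_space \<theta>)"
      proof (intro sets.countable_UN' sets.sets_Collect_finite_All)
        show "countable ?K" by (rule countable_subset[OF _ countable_Collect_finite]) auto
      qed (use measurable_stick in \<open>auto simp: borel_measurable_iff_greater\<close>)
      finally show ?thesis .
    qed
    then show "(\<lambda>u. descending (stick u) k) \<in> borel_measurable (stick_space \<theta>)"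
      by (simp add: borel_measurable_iff_greater)
  qed
qed

lemma sets_PD [measurable_cong]: "sets (PD \<theta>) = sets (restrict_space borel nabla)"
  by (simp add: PD_def)

lemma space_PD [simp]: "space (PD \<theta>) = nabla"
  by (simp add: PD_def space_restrict_space)

lemma prob_space_PD: "0 < \<theta> \<Longrightarrow> prob_space (PD \<theta>)"
  unfolding PD_def
  by (intro prob_space.prob_space_distr prob_space_PiM prob_space_beta1 measurable_descending_stick)

lemma openin_nabla_sets:
  assumes "openin (top_of_set nabla) U" shows "U \<in> sets (PD \<theta>)"
proof -
  obtain T where "open T" "U = nabla \<inter> T" using assms unfolding openin_open by blast
  then show ?thesis unfolding sets_PD sets_restrict_space by (intro image_eqI[of _ _ T]) simp_all
qed

lemma closedin_nabla_sets:
  assumes "closedin (top_of_set nabla) F" shows "F \<in> sets (PD \<theta>)"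
proof -
  obtain T where "closed T" "F = nabla \<inter> T" using assms unfolding closedin_closed by blast
  then show ?thesis unfolding sets_PD sets_restrict_space by (intro image_eqI[of _ _ T]) simp_all
qed

text \<open>
  A cylinder of finitely many intervals for the stick-breaking variables is mapped into \<open>U\<close>; its
  probability is a product of finitely many factors, each at least exponential in \<open>\<theta>\<close>.
\<close>

lemma PD_open_ge:
  assumes U: "openin (top_of_set nabla) U" and "p \<in> U"
  obtains c where "0 < c" "\<And>\<theta>. 1 \<le> \<theta> \<Longrightarrow> c powr \<theta> \<le> measure (PD \<theta>) U"
proof -
  obtain V u where V: "open V" "u \<in> V" and u: "\<And>i. u i \<in> {0<..<1}"
    and VU: "\<And>v. v \<in> V \<Longrightarrow> (\<And>i. v i \<in> {0<..<1}) \<Longrightarrow> descending (stick v) \<in> U"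
    using open_event_into_nabla_open[OF assms] by blast
  have "openin (product_topology (\<lambda>i. euclidean) UNIV) V" using V by (simp add: open_fun_def)
  from product_topology_open_contains_basis[OF this \<open>u \<in> V\<close>]
  obtain X where X: "\<And>i. u i \<in> X i" "\<And>i. open (X i)" "finite {i. X i \<noteq> UNIV}"
    "(\<Pi>\<^sub>E i\<in>UNIV. X i) \<subseteq> V"
    by auto
  define J where "J = {i. X i \<noteq> UNIV}"
  have "\<forall>i. \<exists>c>0. \<forall>\<theta>\<ge>1. c powr \<theta> \<le> measure (beta1 \<theta>) (X i \<inter> {0<..<1})"
    using beta1_open_ge[OF X(2) X(1) u] by metis
  then obtain c where c: "\<And>i. 0 < c i"
      "\<And>i \<theta>. 1 \<le> \<theta> \<Longrightarrow> c i powr \<theta> \<le> measure (beta1 \<theta>) (X i \<inter> {0<..<1})"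
    by metis
  have "(\<Prod>i\<in>J. c i) powr \<theta> \<le> measure (PD \<theta>) U" if "1 \<le> \<theta>" for \<theta>
  proof -
    interpret product_prob_space "\<lambda>i. beta1 \<theta>" UNIV
      using that prob_space_beta1
      by (intro product_prob_space.intro product_sigma_finite.intro product_prob_space_axioms.intro
          prob_space_imp_sigma_finite) auto
    let ?E = "{v \<in> space (stick_space \<theta>). \<forall>i\<in>J. v i \<in> X i \<inter> {0<..<1}}"
    let ?f = "\<lambda>u. descending (stick u)"
    have "(\<Prod>i\<in>J. c i) powr \<theta> = (\<Prod>i\<in>J. c i powr \<theta>)"
      by (rule prod_powr_distrib)
    also have "\<dots> \<le> (\<Prod>i\<in>J. measure (beta1 \<theta>) (X i \<inter> {0<..<1}))"
      using c that by (intro prod_mono) auto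
    also have "\<dots> = measure (stick_space \<theta>) ?E"
    proof -
      have "X i \<inter> {0<..<1} \<in> sets (beta1 \<theta>)" for i
        using X(2) by (auto simp: sets_beta1 sets_restrict_space)
      then have "emeasure (stick_space \<theta>) ?E = (\<Prod>i\<in>J. emeasure (beta1 \<theta>) (X i \<inter> {0<..<1}))"
        using X(3) by (intro emeasure_PiM_Collect) (auto simp: J_def)
      then show ?thesis
        by (simp add: emeasure_eq_measure M.emeasure_eq_measure prod_ennreal prod_nonneg)
    qed
    also have "\<dots> \<le> measure (stick_space \<theta>) (?f -` U \<inter> space (stick_space \<theta>))"
    proof (rule finite_measure_mono)
      have "v \<in> V" if "v \<in> ?E" for v
        using that X(4) by (force simp: J_def)
      then show "?E \<subseteq> ?f -` U \<inter> space (stick_space \<theta>)"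
        using VU by (auto simp: in_stick_space)
      show "?f -` U \<inter> space (stick_space \<theta>) \<in> sets (stick_space \<theta>)"
        using openin_nabla_sets[OF U] measurable_descending_stick
        by (intro measurable_sets) (auto simp: sets_PD)
    qed
    also have "\<dots> = measure (PD \<theta>) U"
      unfolding PD_def using openin_nabla_sets[OF U] measurable_descending_stick
      by (intro measure_distr[symmetric]) (auto simp: sets_PD)
    finally show ?thesis .
  qed
  moreover have "0 < (\<Prod>i\<in>J. c i)" using c by (intro prod_pos) auto
  ultimately show thesis using that by blast
qed

section \<open>Exponential tilting\<close>

context prob_space
begin

context
  fixes H :: "'a \<Rightarrow> real" and B a :: real
  assumes H [measurable]: "H \<in> borel_measurable M" and B: "\<And>x. x \<in> space M \<Longrightarrow> \<bar>H x\<bar> \<le> B"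
begin

lemma integrable_exp_bounded: "integrable M (\<lambda>x. exp (a * H x))"
proof (rule integrable_const_bound)
  show "AE x in M. norm (exp (a * H x)) \<le> exp (\<bar>a\<bar> * B)"
  proof (intro AE_I2)
    fix x assume "x \<in> space M"
    then have "\<bar>a * H x\<bar> \<le> \<bar>a\<bar> * B" using B by (simp add: abs_mult mult_left_mono)
    then show "norm (exp (a * H x)) \<le> exp (\<bar>a\<bar> * B)" by simp
  qed
qed simp

text \<open>
  The Laplace lower bound: keep only the contribution of a set on which the exponent is large.
\<close>

lemma partition_function_ge:
  assumes "U \<in> sets M" "\<And>x. x \<in> U \<Longrightarrow> h \<le> a * H x"
  shows "exp h * prob U \<le> (\<integral>x. exp (a * H x) \<partial>M)"
proof -
  have "exp h * prob U = (\<integral>x. exp h * indicator U x \<partial>M)" using assms by simp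
  also have "\<dots> \<le> (\<integral>x. exp (a * H x) \<partial>M)"
  proof (intro integral_mono integrable_exp_bounded)
    show "integrable M (\<lambda>x. exp h * indicator U x)"
      using assms by (intro integrable_mult_right integrable_real_indicator) (auto simp: emeasure_eq_measure)
  qed (use assms in \<open>auto simp: indicator_def\<close>)
  finally show ?thesis .
qed

lemma partition_function_pos: "0 < (\<integral>x. exp (a * H x) \<partial>M)"
proof -
  have "- (\<bar>a\<bar> * B) \<le> a * H x" if "x \<in> space M" for x
    using B[OF that] abs_le_D2[of "a * H x" "\<bar>a\<bar> * B"] by (simp add: abs_mult mult_left_mono)
  then have "exp (- (\<bar>a\<bar> * B)) * prob (space M) \<le> (\<integral>x. exp (a * H x) \<partial>M)"
    by (intro partition_function_ge) auto
  then show ?thesis by (simp add: prob_space less_le_trans[OF exp_gt_zero])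
qed

abbreviation "tilted \<equiv> density M (\<lambda>x. ennreal (exp (a * H x) / (\<integral>y. exp (a * H y) \<partial>M)))"

lemma prob_space_tilted: "prob_space tilted"
proof
  let ?Z = "\<integral>x. exp (a * H x) \<partial>M"
  have "emeasure tilted (space tilted) = (\<integral>\<^sup>+x. ennreal (exp (a * H x) / ?Z) \<partial>M)"
    by (simp add: emeasure_density cong: nn_integral_cong)
  also have "\<dots> = ennreal (\<integral>x. exp (a * H x) / ?Z \<partial>M)"
    using partition_function_pos integrable_exp_bounded
    by (intro nn_integral_eq_integral) (auto simp: less_imp_le)
  also have "(\<integral>x. exp (a * H x) / ?Z \<partial>M) = 1"
    using partition_function_pos by simp
  finally show "emeasure tilted (space tilted) = 1" by simp
qed

lemma tilted_le:
  assumes F: "F \<in> sets M" "\<And>x. x \<in> F \<Longrightarrow> a * H x \<le> h"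
  shows "measure tilted F \<le> exp h / (\<integral>x. exp (a * H x) \<partial>M)"
proof -
  let ?Z = "\<integral>x. exp (a * H x) \<partial>M"
  interpret T: prob_space tilted by (rule prob_space_tilted)
  have "emeasure tilted F = (\<integral>\<^sup>+x. ennreal (exp (a * H x) / ?Z) * indicator F x \<partial>M)"
    using F by (intro emeasure_density) auto
  also have "\<dots> \<le> (\<integral>\<^sup>+x. ennreal (exp h / ?Z) \<partial>M)"
    using F partition_function_pos
    by (intro nn_integral_mono) (auto simp: indicator_def intro!: ennreal_leI divide_right_mono)
  also have "\<dots> = ennreal (exp h / ?Z)" by (simp add: emeasure_space_1)
  finally show ?thesis
    using partition_function_pos by (simp add: T.emeasure_eq_measure less_imp_le)
qed

end
end

section \<open>The large deviation principle\<close>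

lemma elog_mono:
  assumes "0 \<le> x" "x \<le> y"
  shows "elog x \<le> elog y"
  using assms by (auto simp: elog_def)

theorem theorem5p3:
  fixes \<alpha> :: "real \<Rightarrow> real"
    and H :: "(nat \<Rightarrow> real) \<Rightarrow> real"
    and p0 :: "nat \<Rightarrow> real"
  assumes "filterlim (\<lambda>\<theta>. \<alpha> \<theta> / \<theta>) at_top at_top"
    and "continuous_on nabla H"
    and "bounded (H ` nabla)"
    and "{p \<in> nabla. \<forall>q\<in>nabla. H q \<le> H p} = {p0}"
  shows "satisfies_LDP nabla (tilted_PD H \<alpha>) (\<lambda>p. if p = p0 then 0 else \<infinity>)"
proof -
  let ?Q = "tilted_PD H \<alpha>"
  let ?I = "\<lambda>p. if p = p0 then 0 else \<infinity> :: ereal"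
  have p0: "p0 \<in> nabla" "\<And>q. q \<in> nabla \<Longrightarrow> H q \<le> H p0"
  proof -
    have "p0 \<in> {p \<in> nabla. \<forall>q\<in>nabla. H q \<le> H p}" unfolding assms(4) by simp
    then show "p0 \<in> nabla" "\<And>q. q \<in> nabla \<Longrightarrow> H q \<le> H p0" by simp_all
  qed
  have uniq: "H p < H p0" if p: "p \<in> nabla" "p \<noteq> p0" for p
  proof -
    have "p \<notin> {p \<in> nabla. \<forall>q\<in>nabla. H q \<le> H p}" unfolding assms(4) using p(2) by simp
    then obtain q where "q \<in> nabla" "H p < H q" using p(1) by (auto simp: not_le)
    then show ?thesis using p0(2)[of q] by linarith
  qed
  obtain B where B: "\<And>p. p \<in> nabla \<Longrightarrow> \<bar>H p\<bar> \<le> B"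
    using assms(3) by (auto simp: bounded_iff)
  have H: "H \<in> borel_measurable (PD \<theta>)" for \<theta>
    using borel_measurable_continuous_on_restrict[OF assms(2)]
    by (subst measurable_cong_sets[OF sets_PD refl])
  have prob: "prob_space (?Q \<theta>)" if "0 < \<theta>" for \<theta>
    unfolding tilted_PD_def
    using prob_space.prob_space_tilted[OF prob_space_PD[OF that] H, of B] B by simp
  have sets: "sets (?Q \<theta>) = sets (restrict_space borel nabla)" for \<theta>
    by (simp add: tilted_PD_def sets_PD)
  have space: "space (?Q \<theta>) = nabla" for \<theta> by (simp add: tilted_PD_def)
  \<comment> \<open>Away from the maximiser the tilted mass decays faster than any exponential in \<open>\<theta>\<close>.\<close>
  have rate: "\<exists>e C. 0 < e \<and> (\<forall>\<^sub>F \<theta> in at_top. measure (?Q \<theta>) F \<le> exp (C * \<theta> - e * \<alpha> \<theta>))"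
    if F: "closedin (top_of_set nabla) F" "p0 \<notin> F" for F
  proof -
    have FN: "F \<subseteq> nabla" using F by (simp add: closedin_imp_subset)
    have "\<exists>h<H p0. \<forall>p\<in>F. H p \<le> h"
    proof (cases "F = {}")
      case False
      have "compact F" using F(1) compact_nabla closedin_compact by blast
      then obtain p where "p \<in> F" "\<forall>q\<in>F. H q \<le> H p"
        using continuous_attains_sup[OF _ False continuous_on_subset[OF assms(2) FN]] by blast
      then show ?thesis using uniq FN F(2) by blast
    qed (use lt_ex in auto)
    then obtain h where h: "h < H p0" "\<And>p. p \<in> F \<Longrightarrow> H p \<le> h" by blast
    \<comment> \<open>Half of the gap is given up in \<open>U\<close>, the other half remains as the decay rate.\<close>
    define e where "e = (H p0 - h) / 2"
    have e: "0 < e" "H p0 - e - h = e" using h by (auto simp: e_def field_simps)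
    define U where "U = nabla \<inter> H -` {H p0 - e<..}"
    have U: "openin (top_of_set nabla) U" "p0 \<in> U"
      using continuous_openin_preimage_gen[OF assms(2), of "{H p0 - e<..}"] p0 e by (auto simp: U_def)
    obtain c where c: "0 < c" "\<And>\<theta>. 1 \<le> \<theta> \<Longrightarrow> c powr \<theta> \<le> measure (PD \<theta>) U"
      using PD_open_ge[OF U] by blast
    have "\<forall>\<^sub>F \<theta> in at_top. measure (?Q \<theta>) F \<le> exp (- ln c * \<theta> - e * \<alpha> \<theta>)"
      using eventually_ge_at_top[of 1] filterlim_at_top_dense[THEN iffD1, OF assms(1), rule_format, of 0]
    proof eventually_elim
      case (elim \<theta>)
      then have \<alpha>: "0 < \<alpha> \<theta>" by (simp add: zero_less_divide_iff)
      interpret prob_space "PD \<theta>" using elim by (intro prob_space_PD) auto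
      let ?Z = "\<integral>p. exp (\<alpha> \<theta> * H p) \<partial>PD \<theta>"
      have Z: "exp (\<alpha> \<theta> * (H p0 - e)) * c powr \<theta> \<le> ?Z"
      proof -
        have "exp (\<alpha> \<theta> * (H p0 - e)) * c powr \<theta> \<le> exp (\<alpha> \<theta> * (H p0 - e)) * prob U"
          using c elim by (intro mult_left_mono) auto
        also have "\<dots> \<le> ?Z"
          using \<alpha> by (intro partition_function_ge[OF H, of B] B openin_nabla_sets[OF U(1)])
            (auto simp: U_def less_imp_le)
        finally show ?thesis .
      qed
      have "measure (?Q \<theta>) F \<le> exp (\<alpha> \<theta> * h) / ?Z"
        unfolding tilted_PD_def using \<alpha> h
        by (intro tilted_le[OF H, of B] B closedin_nabla_sets[OF F(1)]) auto
      also have "\<dots> \<le> exp (\<alpha> \<theta> * h) / (exp (\<alpha> \<theta> * (H p0 - e)) * c powr \<theta>)"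
        using Z c by (intro divide_left_mono) (auto intro!: mult_pos_pos less_le_trans[OF _ Z])
      also have "\<dots> = exp (- ln c * \<theta> - (H p0 - e - h) * \<alpha> \<theta>)"
        using c by (simp add: powr_def exp_add[symmetric] exp_diff[symmetric] algebra_simps)
      finally show ?case using e by simp
    qed
    with e show ?thesis by blast
  qed
  have decay: "filterlim (\<lambda>\<theta>. C - e * (\<alpha> \<theta> / \<theta>)) at_bot at_top" if "0 < e" for C e
  proof -
    have "filterlim (\<lambda>\<theta>. - C + e * (\<alpha> \<theta> / \<theta>)) at_top at_top"
      by (intro filterlim_tendsto_add_at_top[OF tendsto_const]
          filterlim_tendsto_pos_mult_at_top[OF tendsto_const that assms(1)])
    then show ?thesis by (simp add: filterlim_uminus_at_bot algebra_simps)
  qed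
  have inf_I: "(INF p\<in>S. ?I p) = (if p0 \<in> S then 0 else \<infinity>)" for S
  proof (cases "p0 \<in> S")
    case True
    have "(INF p\<in>S. ?I p) \<le> ?I p0" by (rule INF_lower[OF True])
    moreover have "0 \<le> (INF p\<in>S. ?I p)" by (rule INF_greatest) simp
    ultimately show ?thesis using True by simp
  next
    case False
    then have "\<infinity> \<le> (INF p\<in>S. ?I p)" by (intro INF_greatest) auto
    then show ?thesis using False by simp
  qed
  show ?thesis
    unfolding satisfies_LDP_def
  proof (intro conjI allI impI ballI)
    fix F assume F: "closedin (top_of_set nabla) F"
    show "Limsup at_top (\<lambda>\<theta>. ereal (1 / \<theta>) * elog (measure (?Q \<theta>) F)) \<le> - (INF p\<in>F. ?I p)"
    proof (cases "p0 \<in> F")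
      case True
      have "\<forall>\<^sub>F \<theta> in at_top. ereal (1 / \<theta>) * elog (measure (?Q \<theta>) F) \<le> 0"
        using eventually_gt_at_top[of 0]
      proof eventually_elim
        case (elim \<theta>)
        have "elog (measure (?Q \<theta>) F) \<le> elog 1"
          using prob_space.prob_le_1[OF prob[OF elim]] by (intro elog_mono) auto
        moreover have "elog 1 = 0" by (simp add: elog_def)
        ultimately have "elog (measure (?Q \<theta>) F) \<le> 0" by simp
        then have "ereal (1 / \<theta>) * elog (measure (?Q \<theta>) F) \<le> ereal (1 / \<theta>) * 0"
          using elim by (intro ereal_mult_left_mono) auto
        then show ?case by simp
      qed
      then show ?thesis using inf_I[of F] True by (simp add: Limsup_bounded)
    next
      case False
      obtain e C where e: "0 < e" and
        bound: "\<forall>\<^sub>F \<theta> in at_top. measure (?Q \<theta>) F \<le> exp (C * \<theta> - e * \<alpha> \<theta>)"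
        using rate[OF F False] by blast
      have "Limsup at_top (\<lambda>\<theta>. ereal (1 / \<theta>) * elog (measure (?Q \<theta>) F))
          \<le> Limsup at_top (\<lambda>\<theta>. ereal (C - e * (\<alpha> \<theta> / \<theta>)))"
      proof (rule Limsup_mono)
        show "\<forall>\<^sub>F \<theta> in at_top. ereal (1 / \<theta>) * elog (measure (?Q \<theta>) F) \<le> ereal (C - e * (\<alpha> \<theta> / \<theta>))"
          using eventually_gt_at_top[of 0] bound
        proof eventually_elim
          case (elim \<theta>)
          then have "elog (measure (?Q \<theta>) F) \<le> elog (exp (C * \<theta> - e * \<alpha> \<theta>))"
            by (intro elog_mono) auto
          then have "ereal (1 / \<theta>) * elog (measure (?Q \<theta>) F) \<le> ereal (1 / \<theta>) * ereal (C * \<theta> - e * \<alpha> \<theta>)"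
            using elim by (intro ereal_mult_left_mono) (auto simp: elog_def)
          then show ?case using elim by (simp add: diff_divide_distrib)
        qed
      qed
      also have "\<dots> = - \<infinity>"
        using decay[OF e]
        by (intro lim_imp_Limsup) (auto simp: tendsto_MInfty filterlim_at_bot_dense)
      finally show ?thesis using inf_I[of F] False by simp
    qed
  next
    fix G assume G: "openin (top_of_set nabla) G"
    show "- (INF p\<in>G. ?I p) \<le> Liminf at_top (\<lambda>\<theta>. ereal (1 / \<theta>) * elog (measure (?Q \<theta>) G))"
    proof (cases "p0 \<in> G")
      case False
      then show ?thesis using inf_I[of G] by simp
    next
      case True
      have "closedin (top_of_set nabla) (nabla - G)" using G by auto
      then obtain e C where e: "0 < e" and
        bound: "\<forall>\<^sub>F \<theta> in at_top. measure (?Q \<theta>) (nabla - G) \<le> exp (C * \<theta> - e * \<alpha> \<theta>)"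
        using rate[of "nabla - G"] True by blast
      \<comment> \<open>For \<open>\<theta> \<ge> 1\<close> this threshold bounds the mass of the complement by \<open>exp (-1) < 1/2\<close>.\<close>
      have "\<forall>\<^sub>F \<theta> in at_top. C - e * (\<alpha> \<theta> / \<theta>) < - 1"
        using decay[OF e] by (simp add: filterlim_at_bot_dense)
      then have "\<forall>\<^sub>F \<theta> in at_top. ereal (ln (1/2) / \<theta>) \<le> ereal (1 / \<theta>) * elog (measure (?Q \<theta>) G)"
        using bound eventually_ge_at_top[of 1]
      proof eventually_elim
        case (elim \<theta>)
        interpret prob_space "?Q \<theta>" using elim by (intro prob) auto
        have "C * \<theta> - e * \<alpha> \<theta> = \<theta> * (C - e * (\<alpha> \<theta> / \<theta>))" using elim by (simp add: field_simps)
        also have "\<dots> \<le> \<theta> * (- 1)" using elim by (intro mult_left_mono) auto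
        finally have "exp (C * \<theta> - e * \<alpha> \<theta>) \<le> exp (- 1)" using elim by simp
        also have "\<dots> \<le> 1/2" using exp_ge_add_one_self[of 1] by (simp add: exp_minus field_simps)
        finally have "measure (?Q \<theta>) (nabla - G) \<le> 1/2" using elim by simp
        moreover have "measure (?Q \<theta>) (nabla - G) = 1 - measure (?Q \<theta>) G"
          using prob_compl[of G] openin_nabla_sets[OF G, of \<theta>] by (simp add: space sets sets_PD)
        ultimately have "elog (1/2) \<le> elog (measure (?Q \<theta>) G)" by (intro elog_mono) auto
        then have "ereal (1 / \<theta>) * ereal (ln (1/2)) \<le> ereal (1 / \<theta>) * elog (measure (?Q \<theta>) G)"
          using elim by (intro ereal_mult_left_mono) (auto simp: elog_def)
        then show ?case by simp
      qed
      from Liminf_mono[OF this]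
      have "Liminf at_top (\<lambda>\<theta>::real. ereal (ln (1/2) / \<theta>))
          \<le> Liminf at_top (\<lambda>\<theta>. ereal (1 / \<theta>) * elog (measure (?Q \<theta>) G))" .
      moreover have "Liminf at_top (\<lambda>\<theta>::real. ereal (ln (1/2) / \<theta>)) = ereal 0"
      proof (intro lim_imp_Liminf)
        have "((\<lambda>\<theta>::real. ln (1/2) / \<theta>) \<longlongrightarrow> 0) at_top"
          by (intro tendsto_divide_0[OF tendsto_const] filterlim_at_top_imp_at_infinity filterlim_ident)
        then show "((\<lambda>\<theta>::real. ereal (ln (1/2) / \<theta>)) \<longlongrightarrow> ereal 0) at_top" by simp
      qed simp
      ultimately show ?thesis using True unfolding inf_I by (simp flip: zero_ereal_def)
    qed
  next
    fix c :: real assume "0 < c"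
    have "{p \<in> nabla. ?I p \<le> ereal c} = {p0}"
      using p0 \<open>0 < c\<close> by auto
    then show "compact {p \<in> nabla. ?I p \<le> ereal c}" by simp
  qed (use prob sets in auto)
qed

end
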